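(* Let $X\in\mathbb{R}^{n\times m}$ with $n\ge2m$. Suppose that the minors $\det\left(X_{\alpha,\{1,\dots,m\}}\right)$ have the same strict sign (all positive or all negative) for all $\alpha$ of the following two kinds: - $\alpha=\{1,\dots,m-r\}\cup\{t,\dots,t+r-1\}$ with $1\le r<m$ and $m-r+1\le t\le n-r+1$; - $\alpha=\{t,\dots,t+m-1\}$ with $1\le t\le m$. Suppose in addition that the minors $\det\left(X_{\alpha,\{1,\dots,m\}}\right)$ with $\alpha=\{t,\dots,t+m-1\}$, $m+1\le t\le n-m+1$, have the same sign in the non-strict sense (i.e. they are all $\ge0$ if the common strict sign above is positive, and all $\le0$ if it is negative). Then $X$ is $m$-sign consistent.
   Context: $X_{\alpha,\beta}$ denotes the submatrix of $X$ with row indices $\alpha$ and column indices $\beta$. A matrix $X\in\mathbb{R}^{n\times m}$ is $m$-sign consistent if all its $m\times m$ minors are nonnegative, or all its $m\times m$ minors are nonpositive. *)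

theory Defs
  imports
    Complex_Main
    "Jordan_Normal_Form.Determinant"
    "Jordan_Normal_Form.DL_Submatrix"
begin

definition minor :: "real mat \<Rightarrow> nat set \<Rightarrow> nat set \<Rightarrow> real" where
  "minor X \<alpha> \<beta> = det (submatrix X \<alpha> \<beta>)"

definition sign_consistent :: "nat \<Rightarrow> real mat \<Rightarrow> bool" where
  "sign_consistent k X \<longleftrightarrow>
     (\<forall>\<alpha> \<beta>. \<alpha> \<subseteq> {0..<dim_row X} \<and> \<beta> \<subseteq> {0..<dim_col X} \<and> card \<alpha> = k \<and> card \<beta> = k
        \<longrightarrow> minor X \<alpha> \<beta> \<ge> 0) \<or>
     (\<forall>\<alpha> \<beta>. \<alpha> \<subseteq> {0..<dim_row X} \<and> \<beta> \<subseteq> {0..<dim_col X} \<and> card \<alpha> = k \<and> card \<beta> = k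
        \<longrightarrow> minor X \<alpha> \<beta> \<le> 0)"

(* Matrix indices start at 0.  Hence the 1-based row sets
     {1..m-r} \<union> {t..t+r-1},  m-r+1 \<le> t \<le> n-r+1,   and   {t..t+m-1},  1 \<le> t \<le> m,
   become the ones below, with t lowered by one. *)
definition strict_row_sets :: "nat \<Rightarrow> nat \<Rightarrow> nat set set" where
  "strict_row_sets n m =
     {{0..<m - r} \<union> {t..<t + r} | r t. 1 \<le> r \<and> r < m \<and> m - r \<le> t \<and> t \<le> n - r} \<union>
     {{t..<t + m} | t. t < m}"

(* 1-based: {t..t+m-1} with m+1 \<le> t \<le> n-m+1. *)
definition weak_row_sets :: "nat \<Rightarrow> nat \<Rightarrow> nat set set" where
  "weak_row_sets n m = {{t..<t + m} | t. m \<le> t \<and> t \<le> n - m}"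

end

theory Submission
  imports Defs
begin

text \<open>
  As a function of the row set, a maximal minor satisfies the three-term Pluecker relation
  \<open>p(S,i,k) p(S,j,l) = p(S,i,j) p(S,k,l) + p(S,i,l) p(S,j,k)\<close>, where \<open>S\<close> has \<open>m - 2\<close> elements and
  \<open>i < j < k < l\<close> lie outside \<open>S\<close>. The argument takes place at the level of these relations, for an
  arbitrary set function \<open>p\<close> that satisfies them.

  The relations run a Fekete-type induction on the dispersion of a row set. Take a row set that contains
  all rows below \<open>z\<close> but not \<open>z\<close>, and let \<open>a\<close> and \<open>b\<close> be its least and its largest row from \<open>z\<close>
  on. If the rows from \<open>a\<close> to \<open>b\<close> do not all belong to it, some \<open>g\<close> between them is missing, and the
  relation for \<open>z < a < g < b\<close> reads
  \<open>p(S,z,g) p(S,a,b) = p(S,z,a) p(S,g,b) + p(S,z,b) p(S,a,g)\<close>.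
  The three factors with row \<open>z\<close> belong to row sets with the longer initial segment \<open>{..z}\<close>, and
  those with \<open>g, b\<close> and \<open>a, g\<close> to less dispersed row sets. If the former are positive, the sign of
  the latter passes to \<open>p(S,a,b)\<close>. So the sign of every minor comes from row sets that consist of
  an initial segment and one block of consecutive rows, which are those of the hypotheses
  (\<open>fekete_dispersion\<close>).

  This runs through \<open>z = m, m - 1, ..., 1\<close> with strict signs and makes every minor with row 0
  positive. The last pass, \<open>z = 0\<close>, divides only by minors with row 0, and sums and positive
  multiples of nonnegative numbers are nonnegative; so weak signs for the blocks of \<open>m\<close> consecutive
  rows give weak signs for the remaining minors (\<open>nonneg_if_initial_sets_pos\<close>). For negative
  minors the same is done with \<open>-p\<close>, as the relations are quadratic.

  The three-term relation comes from the exchange identity \<open>row_det_exchange\<close>, which is Cramer's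
  rule \<open>adj A * A = det A\<close> substituted into a Laplace expansion.
\<close>

section \<open>Determinants of lists of rows\<close>

text \<open>
  Minors are taken along a list of rows, not along a set, so that a row can be replaced or moved
  and the sign of the move can be tracked.
\<close>

definition row_det :: "'a::comm_ring_1 mat \<Rightarrow> nat list \<Rightarrow> 'a" where
  "row_det X xs = det (mat (length xs) (length xs) (\<lambda>(i, j). X $$ (xs ! i, j)))"

text \<open>
  The cofactors do not see the replaced row, so the determinant is a linear form in that row.
\<close>

lemma row_det_update_expand:
  assumes "r < length ys"
  shows "row_det X (ys[r := k]) =
    (\<Sum>c<length ys. X $$ (k, c) *
       cofactor (mat (length ys) (length ys) (\<lambda>(i, j). X $$ (ys ! i, j))) r c)"
proof -
  let ?n = "length ys"
  let ?A = "mat ?n ?n (\<lambda>(i, j). X $$ (ys ! i, j))"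
  let ?B = "mat ?n ?n (\<lambda>(i, j). X $$ (ys[r := k] ! i, j))"
  have del: "mat_delete ?B r c = mat_delete ?A r c" if "c < ?n" for c
    using that assms by (intro eq_matI) (auto simp: mat_delete_def)
  have "row_det X (ys[r := k]) = det ?B"
    by (simp add: row_det_def)
  also have "\<dots> = (\<Sum>c<?n. ?B $$ (r, c) * cofactor ?B r c)"
    by (rule laplace_expansion_row) (use assms in auto)
  also have "\<dots> = (\<Sum>c<?n. X $$ (k, c) * cofactor ?A r c)"
    using assms del by (intro sum.cong) (auto simp: cofactor_def)
  finally show ?thesis .
qed

text \<open>
  Cramer's rule: the coefficients that express a row by the rows \<open>xs\<close> are themselves
  determinants. In this form, multiplied by \<open>row_det X xs\<close>, it also holds when the rows \<open>xs\<close> are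
  linearly dependent.
\<close>

lemma row_det_cramer:
  assumes "c < length xs"
  shows "(\<Sum>q<length xs. row_det X (xs[q := k]) * X $$ (xs ! q, c)) = row_det X xs * X $$ (k, c)"
proof -
  let ?n = "length xs"
  let ?A = "mat ?n ?n (\<lambda>(i, j). X $$ (xs ! i, j))"
  have A: "?A \<in> carrier_mat ?n ?n" by simp
  have adj: "(\<Sum>q<?n. cofactor ?A q d * X $$ (xs ! q, c)) = (if d = c then det ?A else 0)"
    if "d < ?n" for d
  proof -
    have "(\<Sum>q<?n. cofactor ?A q d * X $$ (xs ! q, c)) = (adj_mat ?A * ?A) $$ (d, c)"
      using that assms
      by (auto simp: adj_mat_def times_mat_def scalar_prod_def lessThan_atLeast0 intro!: sum.cong)
    also have "adj_mat ?A * ?A = det ?A \<cdot>\<^sub>m 1\<^sub>m ?n"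
      using adj_mat(3)[OF A] .
    finally show ?thesis using that assms by auto
  qed
  have "(\<Sum>q<?n. row_det X (xs[q := k]) * X $$ (xs ! q, c)) =
        (\<Sum>q<?n. \<Sum>d<?n. X $$ (k, d) * (cofactor ?A q d * X $$ (xs ! q, c)))"
    by (intro sum.cong) (auto simp: row_det_update_expand sum_distrib_right mult.assoc)
  also have "\<dots> = (\<Sum>d<?n. X $$ (k, d) * (\<Sum>q<?n. cofactor ?A q d * X $$ (xs ! q, c)))"
    by (subst sum.swap) (simp add: sum_distrib_left)
  also have "\<dots> = (\<Sum>d<?n. if d = c then X $$ (k, d) * det ?A else 0)"
    by (intro sum.cong) (auto simp: adj)
  also have "\<dots> = row_det X xs * X $$ (k, c)"
    using assms by (simp add: row_det_def)
  finally show ?thesis .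
qed

text \<open>
  The Pluecker exchange identity: the linear form \<open>row_det_update_expand\<close> is applied to the
  expression of row \<open>k\<close> by the rows \<open>xs\<close>.
\<close>

lemma row_det_exchange:
  assumes "length ys = length xs" and "r < length ys"
  shows "row_det X xs * row_det X (ys[r := k]) =
    (\<Sum>q<length xs. row_det X (xs[q := k]) * row_det X (ys[r := xs ! q]))"
proof -
  let ?n = "length xs"
  define C where "C c = cofactor (mat ?n ?n (\<lambda>(i, j). X $$ (ys ! i, j))) r c" for c
  have expand: "row_det X (ys[r := l]) = (\<Sum>c<?n. X $$ (l, c) * C c)" for l
    using row_det_update_expand[OF assms(2), of X l] assms(1) by (simp add: C_def)
  have "row_det X xs * row_det X (ys[r := k]) = (\<Sum>c<?n. (row_det X xs * X $$ (k, c)) * C c)"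
    by (simp add: expand sum_distrib_left mult.assoc)
  also have "\<dots> = (\<Sum>c<?n. \<Sum>q<?n. row_det X (xs[q := k]) * (X $$ (xs ! q, c) * C c))"
    by (intro sum.cong refl, subst row_det_cramer[symmetric])
       (auto simp: sum_distrib_right mult.assoc)
  also have "\<dots> = (\<Sum>q<?n. row_det X (xs[q := k]) * row_det X (ys[r := xs ! q]))"
    by (subst sum.swap) (simp add: expand sum_distrib_left)
  finally show ?thesis .
qed

lemma row_det_repeated_row:
  assumes "\<not> distinct xs"
  shows "row_det X xs = 0"
proof -
  from assms obtain i j where "i < length xs" "j < length xs" "i \<noteq> j" "xs ! i = xs ! j"
    by (auto simp: distinct_conv_nth)
  then show ?thesis
    unfolding row_det_def
    by (intro det_identical_rows[of _ "length xs" i j]) (auto intro!: eq_vecI)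
qed

lemma row_det_swap:
  "row_det X (us @ x # y # vs) = - row_det X (us @ y # x # vs)"
proof -
  let ?n = "length us + length vs + 2"
  let ?B = "mat ?n ?n (\<lambda>(i, j). X $$ ((us @ y # x # vs) ! i, j))"
  let ?k = "length us"
  have "mat ?n ?n (\<lambda>(i, j). X $$ ((us @ x # y # vs) ! i, j)) = swaprows ?k (Suc ?k) ?B"
    by (intro eq_matI) (auto simp: nth_append nth_Cons split: nat.splits)
  moreover have "det (swaprows ?k (Suc ?k) ?B) = - det ?B"
    by (rule det_swaprows[of _ ?n]) auto
  ultimately show ?thesis by (simp add: row_det_def)
qed

lemma row_det_move_right:
  "row_det X (us @ x # vs @ ws) = (- 1) ^ length vs * row_det X (us @ vs @ x # ws)"
proof (induction vs arbitrary: us)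
  case (Cons v vs)
  have "row_det X (us @ x # (v # vs) @ ws) = - row_det X ((us @ [v]) @ x # vs @ ws)"
    using row_det_swap[of X us x v "vs @ ws"] by simp
  also have "\<dots> = (- 1) ^ length (v # vs) * row_det X (us @ (v # vs) @ x # ws)"
    using Cons.IH[of "us @ [v]"] by simp
  finally show ?case .
qed simp

text \<open>
  The exponent is the distance between the two rows: \<open>x\<close> passes \<open>vs\<close> and \<open>ws\<close>, and \<open>y\<close>
  passes \<open>ws\<close>, so the two signs from \<open>ws\<close> cancel.
\<close>

lemma row_det_move_two_last:
  fixes X :: "'a::comm_ring_1 mat"
  shows "row_det X (us @ x # vs @ y # ws) = (- 1) ^ length vs * row_det X (us @ vs @ ws @ [x, y])"
proof -
  have "row_det X (us @ x # vs @ y # ws) = (- 1) ^ length ws * row_det X (us @ x # (vs @ ws) @ [y])"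
    using row_det_move_right[of X "us @ x # vs" y ws "[]"] by simp
  also have "\<dots> = (- 1) ^ length ws * ((- 1) ^ length (vs @ ws) * row_det X (us @ (vs @ ws) @ x # [y]))"
    by (simp only: row_det_move_right)
  also have "\<dots> = ((- 1) ^ length ws * (- 1) ^ length ws) *
      ((- 1) ^ length vs * row_det X (us @ vs @ ws @ [x, y]))"
    by (simp add: power_add ac_simps)
  also have "(- 1) ^ length ws * (- 1) ^ length ws = (1 :: 'a)"
    by (simp flip: power_mult_distrib)
  finally show ?thesis by simp
qed

text \<open>
  In the exchange identity for \<open>ss @ [i, j]\<close> and \<open>ss @ [k, l]\<close>, the terms that exchange \<open>k\<close> with
  a row of \<open>ss\<close> repeat that row in the second factor, and only two terms survive.
\<close>

lemma row_det_three_term_last: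
  "row_det X (ss @ [i, k]) * row_det X (ss @ [j, l]) =
   row_det X (ss @ [i, j]) * row_det X (ss @ [k, l]) +
   row_det X (ss @ [i, l]) * row_det X (ss @ [j, k])"
proof -
  let ?s = "length ss" and ?D = "\<lambda>x y. row_det X (ss @ [x, y])"
  have "?D i j * ?D k l =
      (\<Sum>q<Suc (Suc ?s). row_det X ((ss @ [i, j])[q := k]) *
         row_det X ((ss @ [k, l])[?s := (ss @ [i, j]) ! q]))"
    using row_det_exchange[of "ss @ [k, l]" "ss @ [i, j]" ?s X k] by (simp add: list_update_append)
  also have "\<dots> = (\<Sum>q<?s. row_det X ((ss @ [i, j])[q := k]) *
         row_det X ((ss @ [k, l])[?s := (ss @ [i, j]) ! q])) + ?D k j * ?D i l + ?D i k * ?D j l"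
    by (simp add: list_update_append nth_append)
  also have "(\<Sum>q<?s. row_det X ((ss @ [i, j])[q := k]) *
         row_det X ((ss @ [k, l])[?s := (ss @ [i, j]) ! q])) = 0"
    by (intro sum.neutral ballI) (simp add: list_update_append nth_append row_det_repeated_row)
  also have "?D k j = - ?D j k"
    using row_det_swap[of X ss k j "[]"] by simp
  finally show ?thesis by (simp add: mult.commute)
qed

text \<open>
  When all rows are in their sorted positions, the relation has no signs: each of the three products
  picks up the sign \<open>(- 1) ^ (length b + length d)\<close> when its rows are moved to the end, because
  the length of \<open>c\<close> enters its exponent an even number of times.
\<close>

lemma row_det_three_term:
  fixes X :: "'a::comm_ring_1 mat"
  shows "row_det X (a @ i # b @ c @ k # d @ e) * row_det X (a @ b @ j # c @ d @ l # e) =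
   row_det X (a @ i # b @ j # c @ d @ e) * row_det X (a @ b @ c @ k # d @ l # e) +
   row_det X (a @ i # b @ c @ d @ l # e) * row_det X (a @ b @ j # c @ k # d @ e)"
    (is "?ik * ?jl = ?ij * ?kl + ?il * ?jk")
proof -
  let ?D = "\<lambda>x y. row_det X (a @ b @ c @ d @ e @ [x, y])"
  define \<beta> \<gamma> \<delta> :: 'a
    where "\<beta> = (- 1) ^ length b" and "\<gamma> = (- 1) ^ length c" and "\<delta> = (- 1) ^ length d"
  have move: "?ik = \<beta> * \<gamma> * ?D i k" "?jl = \<gamma> * \<delta> * ?D j l" "?ij = \<beta> * ?D i j"
    "?kl = \<delta> * ?D k l" "?il = \<beta> * \<gamma> * \<delta> * ?D i l" "?jk = \<gamma> * ?D j k"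
    unfolding \<beta>_def \<gamma>_def \<delta>_def
    subgoal using row_det_move_two_last[of X a i "b @ c" k "d @ e"] by (simp add: power_add)
    subgoal using row_det_move_two_last[of X "a @ b" j "c @ d" l e] by (simp add: power_add)
    subgoal using row_det_move_two_last[of X a i b j "c @ d @ e"] by simp
    subgoal using row_det_move_two_last[of X "a @ b @ c" k d l e] by simp
    subgoal using row_det_move_two_last[of X a i "b @ c @ d" l e] by (simp add: power_add mult.assoc)
    subgoal using row_det_move_two_last[of X "a @ b" j c k "d @ e"] by simp
    done
  have \<gamma>: "\<gamma> * \<gamma> = 1"
    by (simp add: \<gamma>_def flip: power_mult_distrib)
  have "?ik * ?jl = (\<gamma> * \<gamma>) * (\<beta> * \<delta> * (?D i k * ?D j l))"
    by (simp only: move ac_simps)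
  also have "?D i k * ?D j l = ?D i j * ?D k l + ?D i l * ?D j k"
    using row_det_three_term_last[of X "a @ b @ c @ d @ e" i k j l] by simp
  also have "(\<gamma> * \<gamma>) * (\<beta> * \<delta> * (?D i j * ?D k l + ?D i l * ?D j k)) =
      \<beta> * ?D i j * (\<delta> * ?D k l) + \<gamma> * \<gamma> * (\<beta> * \<delta> * (?D i l * ?D j k))"
    by (simp only: \<gamma>) (simp add: algebra_simps)
  also have "\<dots> = ?ij * ?kl + ?il * ?jk"
    by (simp only: move ac_simps)
  finally show ?thesis .
qed

section \<open>The three-term relations between minors\<close>

lemma map_pick_eq_sorted_list_of_set:
  assumes "finite \<alpha>"
  shows "map (pick \<alpha>) [0..<card \<alpha>] = sorted_list_of_set \<alpha>"
proof -
  have sorted: "sorted_wrt (<) (map (pick \<alpha>) [0..<card \<alpha>])"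
    by (auto simp: sorted_wrt_iff_nth_less intro: pick_mono_le)
  have "set (map (pick \<alpha>) [0..<card \<alpha>]) = \<alpha>"
  proof (rule card_subset_eq[OF assms])
    show "set (map (pick \<alpha>) [0..<card \<alpha>]) \<subseteq> \<alpha>" by (auto intro: pick_in_set_le)
    show "card (set (map (pick \<alpha>) [0..<card \<alpha>])) = card \<alpha>"
      using sorted by (subst distinct_card) (auto simp: strict_sorted_iff)
  qed
  then show ?thesis
    using sorted assms by (intro strict_sorted_equal) auto
qed

lemma minor_eq_row_det:
  assumes "\<alpha> \<subseteq> {0..<dim_row X}" and "card \<alpha> = m" and "m \<le> dim_col X"
  shows "minor X \<alpha> {0..<m} = row_det X (sorted_list_of_set \<alpha>)"
proof -
  have fin: "finite \<alpha>" using assms(1) finite_subset by blast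
  have rows: "{i. i < dim_row X \<and> i \<in> \<alpha>} = \<alpha>" and cols: "{j. j < dim_col X \<and> j \<in> {0..<m}} = {0..<m}"
    using assms by auto
  have "pick {0..<m} j = j" if "j < m" for j
    using arg_cong[OF map_pick_eq_sorted_list_of_set[of "{0..<m}"], of "\<lambda>xs. xs ! j"] that by simp
  moreover have "pick \<alpha> i = sorted_list_of_set \<alpha> ! i" if "i < m" for i
    using arg_cong[OF map_pick_eq_sorted_list_of_set[OF fin], of "\<lambda>xs. xs ! i"] that assms(2)
    by simp
  ultimately have "submatrix X \<alpha> {0..<m} = mat m m (\<lambda>(i, j). X $$ (sorted_list_of_set \<alpha> ! i, j))"
    unfolding submatrix_def rows cols by (intro eq_matI) (auto simp: assms(2))
  then show ?thesis using assms(2) by (simp add: minor_def row_det_def)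
qed

text \<open>
  The Grassmann-Pluecker relations of this shortest kind, for functions on the \<open>m\<close>-element subsets
  of \<open>{0..<n}\<close>. They are stated for abstract \<open>p\<close> so that they can be used for the minors and for
  their negatives.
\<close>

definition three_term_relations :: "nat \<Rightarrow> nat \<Rightarrow> (nat set \<Rightarrow> real) \<Rightarrow> bool" where
  "three_term_relations n m p \<longleftrightarrow>
     (\<forall>S i j k l. S \<subseteq> {0..<n} \<and> card S + 2 = m \<and> i < j \<and> j < k \<and> k < l \<and> l < n \<and>
        S \<inter> {i, j, k, l} = {} \<longrightarrow>
        p (S \<union> {i, k}) * p (S \<union> {j, l}) =
        p (S \<union> {i, j}) * p (S \<union> {k, l}) + p (S \<union> {i, l}) * p (S \<union> {j, k}))"

lemma three_term_relations_uminus: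
  assumes "three_term_relations n m p"
  shows "three_term_relations n m (\<lambda>\<alpha>. - p \<alpha>)"
  using assms unfolding three_term_relations_def by (simp only: minus_mult_minus)

text \<open>
  The elements of \<open>S\<close> are cut into the five segments between \<open>i\<close>, \<open>j\<close>, \<open>k\<close> and \<open>l\<close>; the six
  sorted row lists then have the form needed for \<open>row_det_three_term\<close>.
\<close>

lemma minor_three_term:
  assumes "m \<le> dim_col X" and "S \<subseteq> {0..<dim_row X}" and "card S + 2 = m"
    and "i < j" "j < k" "k < l" "l < dim_row X" and "S \<inter> {i, j, k, l} = {}"
  shows "minor X (S \<union> {i, k}) {0..<m} * minor X (S \<union> {j, l}) {0..<m} =
    minor X (S \<union> {i, j}) {0..<m} * minor X (S \<union> {k, l}) {0..<m} +
    minor X (S \<union> {i, l}) {0..<m} * minor X (S \<union> {j, k}) {0..<m}"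
proof -
  have fin: "finite S" using assms(2) finite_subset by blast
  define a b c d e where "a = sorted_list_of_set (S \<inter> {..<i})"
    and "b = sorted_list_of_set (S \<inter> {i<..<j})" and "c = sorted_list_of_set (S \<inter> {j<..<k})"
    and "d = sorted_list_of_set (S \<inter> {k<..<l})" and "e = sorted_list_of_set (S \<inter> {l<..})"
  have sets: "set a = S \<inter> {..<i}" "set b = S \<inter> {i<..<j}" "set c = S \<inter> {j<..<k}"
    "set d = S \<inter> {k<..<l}" "set e = S \<inter> {l<..}"
    and sorted: "sorted_wrt (<) a" "sorted_wrt (<) b" "sorted_wrt (<) c" "sorted_wrt (<) d"
      "sorted_wrt (<) e"
    using fin by (simp_all add: a_def b_def c_def d_def e_def)
  have S: "S = set (a @ b @ c @ d @ e)"
  proof -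
    have "x < i \<or> i < x \<and> x < j \<or> j < x \<and> x < k \<or> k < x \<and> x < l \<or> l < x" if "x \<in> S" for x
    proof -
      have "x \<noteq> i" "x \<noteq> j" "x \<noteq> k" "x \<noteq> l" using that assms(8) by auto
      then show ?thesis by linarith
    qed
    note gap = this
    show ?thesis
    proof (intro equalityI subsetI)
      fix x assume "x \<in> S"
      with gap[OF this] show "x \<in> set (a @ b @ c @ d @ e)" by (auto simp: sets)
    qed (auto simp: sets)
  qed
  have minor: "minor X (S \<union> {x, y}) {0..<m} = row_det X zs"
    if "x \<noteq> y" "{x, y} \<subseteq> {i, j, k, l}" "set zs = S \<union> {x, y}" "sorted_wrt (<) zs" for x y zs
  proof -
    have disj: "S \<inter> {x, y} = {}" using that(2) assms(8) by blast
    have "x < dim_row X" "y < dim_row X" using that(2) assms(4-7) by auto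
    then have "S \<union> {x, y} \<subseteq> {0..<dim_row X}" using assms(2) by simp
    moreover have "card (S \<union> {x, y}) = m"
      using that(1) disj assms(3) fin by (simp add: card_Un_disjoint)
    moreover have "sorted_list_of_set (S \<union> {x, y}) = zs"
      using that(4) unfolding that(3)[symmetric]
      by (simp add: strict_sorted_iff sorted_list_of_set.idem_if_sorted_distinct)
    ultimately show ?thesis using assms(1) by (simp add: minor_eq_row_det)
  qed
  have "sorted_wrt (<) (a @ i # b @ j # c @ k # d @ l # e)"
    using sorted assms(4-6) by (auto simp: sorted_wrt_append sets)
  note sorted_all = this[unfolded sorted_wrt_append sorted_wrt.simps set_append list.set ball_Un ball_simps]
  have "minor X (S \<union> {i, k}) {0..<m} = row_det X (a @ i # b @ c @ k # d @ e)"
  proof (rule minor)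
    show "i \<noteq> k" using assms(4-6) by linarith
    show "set (a @ i # b @ c @ k # d @ e) = S \<union> {i, k}" unfolding S by auto
    show "sorted_wrt (<) (a @ i # b @ c @ k # d @ e)"
      using sorted_all by (simp add: sorted_wrt_append ball_Un)
  qed simp
  moreover have "minor X (S \<union> {j, l}) {0..<m} = row_det X (a @ b @ j # c @ d @ l # e)"
  proof (rule minor)
    show "j \<noteq> l" using assms(4-6) by linarith
    show "set (a @ b @ j # c @ d @ l # e) = S \<union> {j, l}" unfolding S by auto
    show "sorted_wrt (<) (a @ b @ j # c @ d @ l # e)"
      using sorted_all by (simp add: sorted_wrt_append ball_Un)
  qed simp
  moreover have "minor X (S \<union> {i, j}) {0..<m} = row_det X (a @ i # b @ j # c @ d @ e)"
  proof (rule minor)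
    show "i \<noteq> j" using assms(4-6) by linarith
    show "set (a @ i # b @ j # c @ d @ e) = S \<union> {i, j}" unfolding S by auto
    show "sorted_wrt (<) (a @ i # b @ j # c @ d @ e)"
      using sorted_all by (simp add: sorted_wrt_append ball_Un)
  qed simp
  moreover have "minor X (S \<union> {k, l}) {0..<m} = row_det X (a @ b @ c @ k # d @ l # e)"
  proof (rule minor)
    show "k \<noteq> l" using assms(4-6) by linarith
    show "set (a @ b @ c @ k # d @ l # e) = S \<union> {k, l}" unfolding S by auto
    show "sorted_wrt (<) (a @ b @ c @ k # d @ l # e)"
      using sorted_all by (simp add: sorted_wrt_append ball_Un)
  qed simp
  moreover have "minor X (S \<union> {i, l}) {0..<m} = row_det X (a @ i # b @ c @ d @ l # e)"
  proof (rule minor)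
    show "i \<noteq> l" using assms(4-6) by linarith
    show "set (a @ i # b @ c @ d @ l # e) = S \<union> {i, l}" unfolding S by auto
    show "sorted_wrt (<) (a @ i # b @ c @ d @ l # e)"
      using sorted_all by (simp add: sorted_wrt_append ball_Un)
  qed simp
  moreover have "minor X (S \<union> {j, k}) {0..<m} = row_det X (a @ b @ j # c @ k # d @ e)"
  proof (rule minor)
    show "j \<noteq> k" using assms(4-6) by linarith
    show "set (a @ b @ j # c @ k # d @ e) = S \<union> {j, k}" unfolding S by auto
    show "sorted_wrt (<) (a @ b @ j # c @ k # d @ e)"
      using sorted_all by (simp add: sorted_wrt_append ball_Un)
  qed simp
  ultimately show ?thesis
    using row_det_three_term[of X a i b c k d e j l] by (simp only:)
qed

lemma three_term_relations_minor:
  assumes "X \<in> carrier_mat n m"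
  shows "three_term_relations n m (\<lambda>\<alpha>. minor X \<alpha> {0..<m})"
  using assms minor_three_term[of m X] unfolding three_term_relations_def by auto

section \<open>Fekete's induction on the dispersion\<close>

text \<open>
  The predicate \<open>R\<close> lets one proof serve both for strict and for weak signs: in the three-term
  relation for \<open>z < a < g < b\<close>, the values on sets that contain \<open>z\<close> are positive coefficients, one of
  which is divided by, whereas the signs of the other values are only passed on.
\<close>

lemma fekete_dispersion:
  fixes p :: "nat set \<Rightarrow> real"
  assumes three_term: "three_term_relations n m p"
    and R: "R = (\<lambda>x. 0 < x) \<or> R = (\<lambda>x. 0 \<le> x)"
    and pos: "\<And>\<alpha>. \<alpha> \<subseteq> {0..<n} \<Longrightarrow> card \<alpha> = m \<Longrightarrow> {..z} \<subseteq> \<alpha> \<Longrightarrow> 0 < p \<alpha>"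
    and interval: "\<And>t. z \<le> t \<Longrightarrow> t + (m - z) \<le> n \<Longrightarrow> R (p ({..<z} \<union> {t..<t + (m - z)}))"
    and "z < m" and "\<alpha> \<subseteq> {0..<n}" and "card \<alpha> = m" and "{..<z} \<subseteq> \<alpha>"
  shows "R (p \<alpha>)"
proof -
  \<comment> \<open>Both meanings of \<open>R\<close> survive the division by \<open>u\<close> in the three-term relation.\<close>
  have cancel: "R v" if "u * v = x * y + x' * y'" "0 < u" "0 < x" "0 < x'" "R y" "R y'"
    for u v x y x' y' :: real
  proof -
    have "R (u * v)" using R that by (auto simp: add_pos_pos)
    then show ?thesis using R \<open>0 < u\<close> by (auto simp: zero_less_mult_iff zero_le_mult_iff)
  qed
  have all: "R (p ({..<z} \<union> T))" if "T \<subseteq> {z..<n}" "card T = m - z" for T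
    using that
  proof (induction "Max T - Min T" arbitrary: T rule: less_induct)
    case less
    have fin: "finite T" using less.prems(1) finite_subset by blast
    have "T \<noteq> {}" using less.prems(2) \<open>z < m\<close> by auto
    define a b where "a = Min T" and "b = Max T"
    have a: "a \<in> T" and b: "b \<in> T" and ab: "\<And>x. x \<in> T \<Longrightarrow> a \<le> x \<and> x \<le> b"
      using fin \<open>T \<noteq> {}\<close> by (auto simp: a_def b_def)
    have card: "card ({..<z} \<union> T') = m" if "T' \<subseteq> {z..<n}" "card T' = m - z" for T'
      using that \<open>z < m\<close> finite_subset[OF that(1)]
      by (subst card_Un_disjoint) auto
    have zn: "z < n" using a less.prems(1) by auto
    show ?case
    proof (cases "z \<in> T")
      case True
      have "0 < p ({..<z} \<union> T)"
      proof (intro pos)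
        show "{..<z} \<union> T \<subseteq> {0..<n}" using less.prems(1) zn by auto
        show "card ({..<z} \<union> T) = m" using less.prems by (rule card)
        show "{..z} \<subseteq> {..<z} \<union> T" using True by (simp add: subset_iff le_less)
      qed
      then show ?thesis using R by auto
    next
      case z: False
      show ?thesis
      proof (cases "T = {a..b}")
        case True
        then have "m - z = Suc b - a" using less.prems(2) by simp
        then have "a + (m - z) = Suc b" using ab[OF a] by simp
        moreover have "z \<le> a" "b < n" using a b less.prems(1) by auto
        ultimately show ?thesis
          using interval[of a] True by (simp add: atLeastLessThanSuc_atLeastAtMost)
      next
        case False
        then obtain g where g: "a < g" "g < b" "g \<notin> T"
          using a b ab by (metis atLeastAtMost_iff order_le_less subsetI subset_antisym)
        have za: "z < a" using z a less.prems(1) by (metis atLeastLessThan_iff order_le_less subsetD)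
        have bn: "b < n" using b less.prems(1) by auto
        define S' where "S' = T - {a, b}"
        define S where "S = {..<z} \<union> S'"
        have T: "T = S' \<union> {a, b}" using a b by (auto simp: S'_def)
        have S': "S' \<subseteq> {a<..<b}" using ab by (force simp: S'_def)
        have "finite S'" using fin by (simp add: S'_def)
        have cS': "card S' + 2 = m - z"
          using less.prems(2) g(1,2) \<open>finite S'\<close> unfolding T
          by (subst (asm) card_Un_disjoint) (auto simp: S'_def)
        have cS: "card S + 2 = m"
          using S' za cS' \<open>finite S'\<close> \<open>z < m\<close> unfolding S_def by (subst card_Un_disjoint) auto
        have S_sub: "S \<subseteq> {0..<n}" using S' zn bn by (auto simp: S_def)
        have S_disj: "S \<inter> {z, a, g, b} = {}"
          using S' za g T by (auto simp: S_def)
        have pos': "0 < p (S \<union> {z, x})" if "x \<in> {a, g, b}" for x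
        proof (rule pos)
          show "S \<union> {z, x} \<subseteq> {0..<n}" using S_sub that za g bn by auto
          show "card (S \<union> {z, x}) = m"
            using S_disj cS that za g finite_subset[OF S_sub] by (subst card_Un_disjoint) auto
          show "{..z} \<subseteq> S \<union> {z, x}" by (auto simp: S_def)
        qed
        have narrower: "R (p (S \<union> {x, y}))"
          if "S' \<union> {x, y} \<subseteq> {c..d}" "d - c < b - a" "z \<le> c" "d < n"
            "x \<noteq> y" "S' \<inter> {x, y} = {}" for c d x y
        proof -
          let ?T = "S' \<union> {x, y}"
          have "finite ?T" using \<open>finite S'\<close> by simp
          then have "c \<le> Min ?T" "Max ?T \<le> d" using that(1) by auto
          then have "Max ?T - Min ?T < Max T - Min T"
            using that(2) unfolding a_def b_def by linarith
          moreover have "?T \<subseteq> {z..<n}" using that(1,3,4) by fastforce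
          moreover have "card ?T = m - z"
            using that(5,6) cS' \<open>finite S'\<close> by (subst card_Un_disjoint) auto
          ultimately have "R (p ({..<z} \<union> ?T))" by (rule less.hyps)
          then show ?thesis by (simp add: S_def Un_assoc)
        qed
        have eq: "p (S \<union> {z, g}) * p (S \<union> {a, b}) =
            p (S \<union> {z, a}) * p (S \<union> {g, b}) + p (S \<union> {z, b}) * p (S \<union> {a, g})"
          using three_term S_sub cS za g bn S_disj unfolding three_term_relations_def by blast
        have gb: "R (p (S \<union> {g, b}))"
          using S' g T za bn by (intro narrower[of g b "Suc a" b]) auto
        have ag: "R (p (S \<union> {a, g}))"
          using S' g T za bn by (intro narrower[of a g a "b - 1"]) fastforce+
        have "R (p (S \<union> {a, b}))"
          by (rule cancel[OF eq pos' pos' pos' gb ag]) simp_all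
        then show ?thesis by (simp add: S_def T Un_assoc)
      qed
    qed
  qed
  have "\<alpha> - {..<z} \<subseteq> {z..<n}" "{..<z} \<union> (\<alpha> - {..<z}) = \<alpha>"
    using assms by auto
  moreover have "card (\<alpha> - {..<z}) = m - z"
    using assms by (subst card_Diff_subset) auto
  ultimately show ?thesis
    using all[of "\<alpha> - {..<z}"] by simp
qed

text \<open>
  Downward induction on the length \<open>z\<close> of the initial segment shows that \<open>p\<close> is positive on all sets
  that contain 0. The remaining sets, with \<open>z = 0\<close>, are treated in a separate last pass because
  there the blocks of \<open>m\<close> consecutive elements have only weak signs.
\<close>

lemma nonneg_if_initial_sets_pos:
  fixes p :: "nat set \<Rightarrow> real"
  assumes three_term: "three_term_relations n m p"
    and "0 < m"
    and top: "0 < p {..<m}"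
    and initial: "\<And>z t. 0 < z \<Longrightarrow> z < m \<Longrightarrow> z \<le> t \<Longrightarrow> t + (m - z) \<le> n \<Longrightarrow>
      0 < p ({..<z} \<union> {t..<t + (m - z)})"
    and interval: "\<And>t. t + m \<le> n \<Longrightarrow> 0 \<le> p {t..<t + m}"
    and \<alpha>: "\<alpha> \<subseteq> {0..<n}" "card \<alpha> = m"
  shows "0 \<le> p \<alpha>"
proof -
  have pos: "0 < p \<beta>" if "z \<le> m" "0 < z" "\<beta> \<subseteq> {0..<n}" "card \<beta> = m" "{..<z} \<subseteq> \<beta>" for z \<beta>
    using that
  proof (induction z arbitrary: \<beta> rule: inc_induct)
    case base
    have "finite \<beta>" using base(2) finite_subset by blast
    with base have "{..<m} = \<beta>" by (intro card_subset_eq) auto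
    with top show ?case by simp
  next
    case (step z)
    show ?case
    proof (rule fekete_dispersion[where p = p and n = n and m = m and z = z and R = "\<lambda>x. 0 < x"])
      show "0 < p \<gamma>" if "\<gamma> \<subseteq> {0..<n}" "card \<gamma> = m" "{..z} \<subseteq> \<gamma>" for \<gamma>
        using step.IH[of \<gamma>] that by (simp add: lessThan_Suc_atMost)
      show "0 < p ({..<z} \<union> {t..<t + (m - z)})" if "z \<le> t" "t + (m - z) \<le> n" for t
        using initial that step by simp
    qed (use step three_term in simp_all)
  qed
  show ?thesis
  proof (rule fekete_dispersion[where p = p and n = n and m = m and z = 0 and R = "\<lambda>x. 0 \<le> x"])
    show "0 < p \<gamma>" if "\<gamma> \<subseteq> {0..<n}" "card \<gamma> = m" "{..0} \<subseteq> \<gamma>" for \<gamma>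
      using pos[of 1 \<gamma>] that \<open>0 < m\<close> by (simp add: lessThan_Suc_atMost)
    show "0 \<le> p ({..<0} \<union> {t..<t + (m - 0)})" if "t + (m - 0) \<le> n" for t
      using interval that by simp
  qed (use \<alpha> \<open>0 < m\<close> three_term in simp_all)
qed

section \<open>Sign consistency\<close>

lemma consecutive_rows_in_row_sets:
  assumes "t + m \<le> n"
  shows "{t..<t + m} \<in> strict_row_sets n m \<union> weak_row_sets n m"
proof (cases "t < m")
  case True
  then show ?thesis unfolding strict_row_sets_def by blast
next
  case False
  then show ?thesis using assms unfolding weak_row_sets_def by force
qed

lemma initial_rows_in_strict_row_sets:
  assumes "0 < z" "z < m" "z \<le> t" "t + (m - z) \<le> n"
  shows "{..<z} \<union> {t..<t + (m - z)} \<in> strict_row_sets n m"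
proof -
  have "{..<z} = {0..<m - (m - z)}" using assms by auto
  moreover have "1 \<le> m - z" "m - z < m" "m - (m - z) \<le> t" "t \<le> n - (m - z)"
    using assms by auto
  ultimately show ?thesis unfolding strict_row_sets_def by blast
qed

theorem theorem5:
  fixes X :: "real mat" and n m :: nat
  assumes "X \<in> carrier_mat n m"
    and "2 * m \<le> n"
    and "((\<forall>\<alpha> \<in> strict_row_sets n m. minor X \<alpha> {0..<m} > 0) \<and>
          (\<forall>\<alpha> \<in> weak_row_sets n m. minor X \<alpha> {0..<m} \<ge> 0)) \<or>
         ((\<forall>\<alpha> \<in> strict_row_sets n m. minor X \<alpha> {0..<m} < 0) \<and>
          (\<forall>\<alpha> \<in> weak_row_sets n m. minor X \<alpha> {0..<m} \<le> 0))"
  shows "sign_consistent m X"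
proof -
  have dims: "dim_row X = n" "dim_col X = m" using assms(1) by auto
  have cols: "\<beta> = {0..<m}" if "\<beta> \<subseteq> {0..<dim_col X}" "card \<beta> = m" for \<beta>
    using that by (intro card_subset_eq) (auto simp: dims)
  show ?thesis
  proof (cases "m = 0")
    case True
    \<comment> \<open>There is no initial block of rows to start the induction from, but all minors are empty determinants.\<close>
    have "minor X \<alpha> \<beta> = 1" if "\<alpha> \<subseteq> {0..<n}" "\<beta> \<subseteq> {0..<m}" "card \<alpha> = 0" for \<alpha> \<beta>
      using that True finite_subset[OF that(1)] by (simp add: minor_def submatrix_def)
    then show ?thesis using True by (simp add: sign_consistent_def dims)
  next
    case False
    let ?p = "\<lambda>\<alpha>. minor X \<alpha> {0..<m}"
    have nonneg: "0 \<le> p \<alpha>"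
      if rel: "three_term_relations n m p" and strict: "\<forall>\<alpha> \<in> strict_row_sets n m. 0 < p \<alpha>"
        and weak: "\<forall>\<alpha> \<in> weak_row_sets n m. 0 \<le> p \<alpha>"
        and \<alpha>: "\<alpha> \<subseteq> {0..<n}" "card \<alpha> = m" for p \<alpha>
    proof (rule nonneg_if_initial_sets_pos[OF rel])
      show "0 < m" using False by simp
      have "{..<m} = {0..<0 + m}" by auto
      then have "{..<m} \<in> strict_row_sets n m"
        using \<open>0 < m\<close> unfolding strict_row_sets_def by blast
      then show "0 < p {..<m}" using strict by blast
      show "0 < p ({..<z} \<union> {t..<t + (m - z)})"
        if "0 < z" "z < m" "z \<le> t" "t + (m - z) \<le> n" for z t
        using strict initial_rows_in_strict_row_sets[OF that] by blast
      show "0 \<le> p {t..<t + m}" if "t + m \<le> n" for t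
        using consecutive_rows_in_row_sets[OF that] strict weak by (auto intro: less_imp_le)
    qed (use \<alpha> in auto)
    have rel: "three_term_relations n m ?p"
      by (rule three_term_relations_minor[OF assms(1)])
    from assms(3) show ?thesis
    proof (elim disjE conjE)
      assume "\<forall>\<alpha> \<in> strict_row_sets n m. minor X \<alpha> {0..<m} > 0"
        and "\<forall>\<alpha> \<in> weak_row_sets n m. minor X \<alpha> {0..<m} \<ge> 0"
      then have "0 \<le> ?p \<alpha>" if "\<alpha> \<subseteq> {0..<n}" "card \<alpha> = m" for \<alpha>
        using nonneg[OF rel] that by blast
      then show ?thesis unfolding sign_consistent_def using cols dims by metis
    next
      assume "\<forall>\<alpha> \<in> strict_row_sets n m. minor X \<alpha> {0..<m} < 0"
        and "\<forall>\<alpha> \<in> weak_row_sets n m. minor X \<alpha> {0..<m} \<le> 0"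
      then have "0 \<le> - ?p \<alpha>" if "\<alpha> \<subseteq> {0..<n}" "card \<alpha> = m" for \<alpha>
        using nonneg[OF three_term_relations_uminus[OF rel]] that by simp
      then have "?p \<alpha> \<le> 0" if "\<alpha> \<subseteq> {0..<n}" "card \<alpha> = m" for \<alpha>
        using that by fastforce
      then show ?thesis unfolding sign_consistent_def using cols dims by metis
    qed
  qed
qed

end
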